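(* Consider a block-structured inhomogeneous spiked Wigner model whose variance profiles $\Delta^{(N)}$ ($N\ge 1$) are block-structured with parameters $(\bar\Delta,\rho_1,\dots,\rho_n)$ (entries equal to $+\infty$ are allowed). Let $\Phi^{(N)}$ and $\bar\Phi$ be the entrywise reciprocals of $\Delta^{(N)}$ and $\bar\Delta$. Then the limit $\widehat\mu_1 := \lim_{N\to\infty} \lambda_1(\Phi^{(N)})/N$ exists and $$\widehat{\mu}_1 = \lim_{N \to \infty} \frac{\lambda_1(\Phi^{(N)})}{N} = \lambda_1\left(\mathrm{diag}(\rho)^{1/2}\, \bar{\Phi}\, \mathrm{diag}(\rho)^{1/2}\right).$$ Moreover, the quantity $$\beta_* := \sqrt{\frac{1}{\lambda_1(\mathrm{diag}(\rho)^{1/2}\, \bar{\Phi}\, \mathrm{diag}(\rho)^{1/2})}}$$ satisfies $\beta_* = 1/\sqrt{\widehat{\mu}_1}$.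
   Context: For a real symmetric matrix, $\lambda_1$ denotes its largest eigenvalue. $\mathrm{diag}(\rho)$ is the diagonal matrix with diagonal entries $\rho_1,\dots,\rho_n$. Block structure: a sequence of symmetric matrices $\Delta^{(N)} \in (\mathbb{R}_{>0}\cup\{+\infty\})^{N\times N}$, $N\ge 1$, is block-structured with parameters $(\bar\Delta,\rho_1,\dots,\rho_n)$, where $n\ge 1$ is fixed, $\rho_1,\dots,\rho_n \in (0,1]$ with $\rho_1+\cdots+\rho_n=1$, and $\bar\Delta \in (\mathbb{R}_{>0}\cup\{+\infty\})^{n\times n}$ is symmetric, if for each $N$ there is a function $q=q_N:[N]\to[n]$ with $\Delta^{(N)}_{ij} = \bar\Delta_{q(i)q(j)}$ for all $i,j\in[N]$, and $|q_N^{-1}(a)|/N \to \rho_a$ as $N\to\infty$ for each $a\in[n]$. Entrywise reciprocals use the convention $1/(+\infty)=0$: $\Phi^{(N)}_{ij} = 1/\Delta^{(N)}_{ij}$ if $\Delta^{(N)}_{ij}\ne+\infty$ and $0$ otherwise, and likewise for $\bar\Phi$ and $\bar\Delta$. In the trivial case $\bar\Phi=0$ we use the convention $1/0=+\infty$ (so $\beta_*=+\infty$). *)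

theory Defs
  imports
    "HOL-Analysis.Analysis"
    "Jordan_Normal_Form.Char_Poly"
begin

text \<open>Row, column and block indices start at 0, so \<open>[N]\<close> is \<open>{..<N}\<close> and \<open>[n]\<close> is \<open>{..<n}\<close>.\<close>

definition lambda1 :: "real mat \<Rightarrow> real" where
  "lambda1 A = Max {k. eigenvalue A k}"

definition variance_profile :: "nat \<Rightarrow> ereal mat \<Rightarrow> bool" where
  "variance_profile m D \<longleftrightarrow>
     D \<in> carrier_mat m m \<and> transpose_mat D = D \<and> (\<forall>i<m. \<forall>j<m. 0 < D $$ (i, j))"

definition recip :: "ereal \<Rightarrow> real" where
  "recip x = (if x = \<infinity> then 0 else 1 / real_of_ereal x)"

abbreviation recip_mat :: "ereal mat \<Rightarrow> real mat" where
  "recip_mat \<equiv> map_mat recip"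

text \<open>The value of the sequence \<open>\<Delta>\<close> at \<open>N = 0\<close> is irrelevant; only \<open>N \<ge> 1\<close> is constrained.\<close>

definition block_structured ::
    "(nat \<Rightarrow> ereal mat) \<Rightarrow> nat \<Rightarrow> ereal mat \<Rightarrow> (nat \<Rightarrow> real) \<Rightarrow> bool" where
  "block_structured \<Delta> n \<Delta>b \<rho> \<longleftrightarrow>
     n \<ge> 1 \<and>
     (\<forall>a<n. 0 < \<rho> a \<and> \<rho> a \<le> 1) \<and> (\<Sum>a<n. \<rho> a) = 1 \<and>
     variance_profile n \<Delta>b \<and>
     (\<forall>N\<ge>1. variance_profile N (\<Delta> N)) \<and>
     (\<exists>q :: nat \<Rightarrow> nat \<Rightarrow> nat.
        (\<forall>N\<ge>1. q N \<in> {..<N} \<rightarrow> {..<n} \<and>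
                (\<forall>i<N. \<forall>j<N. \<Delta> N $$ (i, j) = \<Delta>b $$ (q N i, q N j))) \<and>
        (\<forall>a<n. (\<lambda>N. real (card {i \<in> {..<N}. q N i = a}) / real N) \<longlonglongrightarrow> \<rho> a))"

text \<open>The matrix \<open>diag(\<rho>)\<^sup>1\<^sup>/\<^sup>2 \<Phi> diag(\<rho>)\<^sup>1\<^sup>/\<^sup>2\<close>; the square root of a nonnegative diagonal matrix
  is taken entrywise on the diagonal.\<close>

definition weighted_mat :: "nat \<Rightarrow> (nat \<Rightarrow> real) \<Rightarrow> real mat \<Rightarrow> real mat" where
  "weighted_mat n \<rho> \<Phi> =
     mat_diag n (\<lambda>a. sqrt (\<rho> a)) * \<Phi> * mat_diag n (\<lambda>a. sqrt (\<rho> a))"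

text \<open>Square root on \<open>[0, \<infinity>]\<close>; values at negative arguments are junk.\<close>

definition ereal_sqrt :: "ereal \<Rightarrow> ereal" where
  "ereal_sqrt x = (if x = \<infinity> then \<infinity> else ereal (sqrt (real_of_ereal x)))"

text \<open>Division is that of \<^typ>\<open>ereal\<close>, in which \<open>1 / 0 = \<infinity>\<close>.\<close>

definition beta_star :: "nat \<Rightarrow> (nat \<Rightarrow> real) \<Rightarrow> ereal mat \<Rightarrow> ereal" where
  "beta_star n \<rho> \<Delta>b = ereal_sqrt (1 / ereal (lambda1 (weighted_mat n \<rho> (recip_mat \<Delta>b))))"

end

theory Submission
  imports Defs
begin

text \<open>By the Rayleigh principle, \<open>\<lambda>\<^sub>1\<close> of a symmetric matrix is the maximum of its quadratic form
  on the unit sphere. Grouping coordinates by block turns the form of \<open>\<Phi>\<^sup>(\<^sup>N\<^sup>)\<close> into \<open>N\<close> times that of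
  \<open>diag(c)\<^sup>1\<^sup>/\<^sup>2 \<Phi>b diag(c)\<^sup>1\<^sup>/\<^sup>2\<close>, where \<open>c\<close> are the empirical block proportions, so
  \<open>\<lambda>\<^sub>1(\<Phi>\<^sup>(\<^sup>N\<^sup>))/N\<close> equals \<open>\<lambda>\<^sub>1\<close> of this \<open>n \<times> n\<close> matrix exactly. It remains to let \<open>c \<rightarrow> \<rho>\<close>, using that
  \<open>\<lambda>\<^sub>1\<close> is Lipschitz in the matrix entries.\<close>

section \<open>Quadratic forms and squared norms\<close>

text \<open>Vectors are functions on \<open>nat\<close> of which only the values below
  \<open>n\<close> count, so that the product topology on functions can supply compactness.\<close>

definition qform :: "nat \<Rightarrow> real mat \<Rightarrow> (nat \<Rightarrow> real) \<Rightarrow> real" where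
  "qform n A x = (\<Sum>i<n. \<Sum>j<n. A $$ (i, j) * x i * x j)"

definition sqnorm :: "nat \<Rightarrow> (nat \<Rightarrow> real) \<Rightarrow> real" where
  "sqnorm n x = (\<Sum>i<n. (x i)\<^sup>2)"

lemma sqnorm_nonneg: "0 \<le> sqnorm n x"
  by (simp add: sqnorm_def sum_nonneg)

lemma coord_sq_le_sqnorm: "i < n \<Longrightarrow> (x i)\<^sup>2 \<le> sqnorm n x"
  unfolding sqnorm_def by (rule member_le_sum) auto

lemma sqnorm_scale: "sqnorm n (\<lambda>i. c * x i) = c\<^sup>2 * sqnorm n x"
  by (simp add: sqnorm_def power_mult_distrib sum_distrib_left)

lemma qform_scale: "qform n A (\<lambda>i. c * x i) = c\<^sup>2 * qform n A x"
  by (simp add: qform_def power2_eq_square sum_distrib_left algebra_simps)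

lemma qform_eq_sum: "qform n A x = (\<Sum>i<n. x i * (\<Sum>j<n. A $$ (i, j) * x j))"
  by (simp add: qform_def sum_distrib_left algebra_simps)

lemma qform_cong: "(\<And>i. i < n \<Longrightarrow> x i = y i) \<Longrightarrow> qform n A x = qform n A y"
  unfolding qform_def by (intro sum.cong) auto

section \<open>The Rayleigh principle\<close>

text \<open>Extreme value theorem on the unit sphere. The sphere itself is not compact in this
  function type, since the coordinates from \<open>n\<close> on are free; pinning them to 0 makes it
  so.\<close>

lemma qform_max_attained:
  assumes "n \<ge> 1"
  obtains v where "sqnorm n v = 1" "\<And>x. sqnorm n x = 1 \<Longrightarrow> qform n A x \<le> qform n A v"
proof -
  \<comment> \<open>By Tychonoff this box is compact; it is large enough because the coordinates of
    a unit vector lie in \<open>{-1..1}\<close>.\<close>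
  define K :: "(nat \<Rightarrow> real) set" where
    "K = (\<Pi>\<^sub>E i\<in>UNIV. if i < n then {-1..1} else {0})"
  define S where "S = K \<inter> {x. sqnorm n x = 1}"
  have "compactin (product_topology (\<lambda>i::nat. euclidean :: real topology) UNIV) K"
    unfolding K_def by (subst compactin_PiE) auto
  then have "compact K"
    by (simp add: euclidean_product_topology)
  have coord: "continuous_on UNIV (\<lambda>x :: nat \<Rightarrow> real. x i)" for i
    by (rule continuous_on_product_coordinates)
  have cont_sq: "continuous_on UNIV (sqnorm n)"
    unfolding sqnorm_def by (intro continuous_intros coord)
  have cont_q: "continuous_on UNIV (qform n A)"
    unfolding qform_def by (intro continuous_intros coord)
  have "closed {x. sqnorm n x = 1}"
    using continuous_closed_vimage[of "{1}" "sqnorm n"] cont_sq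
    by (simp add: vimage_def continuous_on_eq_continuous_at)
  with \<open>compact K\<close> have "compact S"
    unfolding S_def by (rule compact_Int_closed)
  \<comment> \<open>Truncation alters neither \<open>sqnorm n\<close> nor \<open>qform n A\<close>,
    so a maximum over \<open>S\<close> is a maximum over all unit vectors.\<close>
  have trunc: "(\<lambda>i. if i < n then x i else 0) \<in> S" if "sqnorm n x = 1" for x
  proof -
    have "\<bar>x i\<bar> \<le> 1" if "i < n" for i
      using coord_sq_le_sqnorm[OF that, of x] \<open>sqnorm n x = 1\<close> by (simp add: abs_square_le_1)
    with that show ?thesis
      by (auto simp: S_def K_def sqnorm_def abs_le_iff minus_le_iff)
  qed
  have "sqnorm n (\<lambda>i. if i = 0 then 1 else 0) = 1"
    using assms by (simp add: sqnorm_def if_distrib[of "\<lambda>x. x\<^sup>2"] sum.delta cong: if_cong)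
  with trunc have "S \<noteq> {}" by blast
  then obtain v where v: "v \<in> S" "\<And>x. x \<in> S \<Longrightarrow> qform n A x \<le> qform n A v"
    using continuous_attains_sup[OF \<open>compact S\<close>, of "qform n A"] cont_q
    by (meson continuous_on_subset subset_UNIV)
  show thesis
  proof
    show "sqnorm n v = 1" using v by (simp add: S_def)
    fix x :: "nat \<Rightarrow> real" assume "sqnorm n x = 1"
    from v(2)[OF trunc[OF this]] show "qform n A x \<le> qform n A v"
      by (subst qform_cong[where y = "\<lambda>i. if i < n then x i else 0"]) auto
  qed
qed

text \<open>Both sides are homogeneous of degree two, so \<open>x\<close> may be normalised; if
  \<open>sqnorm n x = 0\<close>, the coordinates below \<open>n\<close> vanish and both sides are
  0.\<close>

lemma qform_le_of_unit_bound:
  assumes "\<And>x. sqnorm n x = 1 \<Longrightarrow> qform n A x \<le> l"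
  shows "qform n A x \<le> l * sqnorm n x"
proof (cases "sqnorm n x = 0")
  case True
  then have "x i = 0" if "i < n" for i
    using coord_sq_le_sqnorm[OF that, of x] by simp
  then have "qform n A x = 0" by (simp add: qform_def)
  with True show ?thesis by simp
next
  case False
  define s where "s = sqnorm n x"
  have s: "s > 0" using False sqnorm_nonneg[of n x] by (simp add: s_def)
  have "(1 / sqrt s)\<^sup>2 * sqnorm n x = 1"
    using s by (simp add: power_divide s_def)
  from assms[of "\<lambda>i. 1 / sqrt s * x i", unfolded sqnorm_scale qform_scale, OF this]
  show ?thesis using s by (simp add: power_divide s_def field_simps)
qed

text \<open>First variation: \<open>v + t w\<close> with \<open>w = l v - A v\<close> cannot beat the bound for small \<open>t\<close>.\<close>

lemma qform_maximizer_eigen: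
  assumes sym: "\<And>i j. i < n \<Longrightarrow> j < n \<Longrightarrow> A $$ (i, j) = A $$ (j, i)"
    and bound: "\<And>x. qform n A x \<le> l * sqnorm n x"
    and eq: "qform n A v = l * sqnorm n v"
    and i: "i < n"
  shows "(\<Sum>j<n. A $$ (i, j) * v j) = l * v i"
proof -
  define g where "g = (\<lambda>i. \<Sum>j<n. A $$ (i, j) * v j)"
  define w where "w = (\<lambda>i. l * v i - g i)"
  define b where "b = (\<Sum>i<n. w i * g i)"
  define c where "c = (\<Sum>i<n. w i * v i)"
  have swap: "(\<Sum>i<n. \<Sum>j<n. A $$ (i, j) * v i * w j) = b"
    unfolding b_def g_def sum_distrib_left
    by (subst sum.swap, intro sum.cong) (auto simp: sym algebra_simps)
  have b': "(\<Sum>i<n. \<Sum>j<n. A $$ (i, j) * w i * v j) = b"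
    unfolding b_def g_def sum_distrib_left by (intro sum.cong) (auto simp: algebra_simps)
  have q: "qform n A (\<lambda>i. v i + t * w i) = qform n A v + 2 * t * b + t\<^sup>2 * qform n A w" for t
  proof -
    have "qform n A (\<lambda>i. v i + t * w i) = qform n A v
        + t * (\<Sum>i<n. \<Sum>j<n. A $$ (i, j) * v i * w j)
        + t * (\<Sum>i<n. \<Sum>j<n. A $$ (i, j) * w i * v j) + t\<^sup>2 * qform n A w"
      unfolding qform_def sum_distrib_left sum.distrib[symmetric]
      by (intro sum.cong) (auto simp: algebra_simps power2_eq_square)
    then show ?thesis by (simp add: swap b')
  qed
  have s: "sqnorm n (\<lambda>i. v i + t * w i) = sqnorm n v + 2 * t * c + t\<^sup>2 * sqnorm n w" for t
    unfolding sqnorm_def c_def sum_distrib_left sum.distrib[symmetric]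
    by (intro sum.cong) (auto simp: algebra_simps power2_eq_square)
  have cb: "l * c - b = sqnorm n w"
    unfolding sqnorm_def c_def b_def sum_distrib_left sum_subtractf[symmetric]
    by (intro sum.cong) (auto simp: w_def algebra_simps power2_eq_square)
  define d where "d = l * sqnorm n w - qform n A w"
  have d: "d \<ge> 0" using bound[of w] by (simp add: d_def)
  \<comment> \<open>The constant terms cancel by \<open>eq\<close>, and by \<open>cb\<close> the
    linear coefficient is twice \<open>sqnorm n w\<close>.\<close>
  have key: "0 \<le> 2 * t * sqnorm n w + t\<^sup>2 * d" for t
    using bound[of "\<lambda>i. v i + t * w i"] eq unfolding q s cb[symmetric] d_def
    by (simp add: algebra_simps)
  have "sqnorm n w = 0"
  proof (rule ccontr)
    assume "sqnorm n w \<noteq> 0"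
    then have p: "sqnorm n w > 0" using sqnorm_nonneg[of n w] by simp
    \<comment> \<open>Up to the \<open>+ 1\<close>, which guards against \<open>d = 0\<close>, this
      is the minimiser of the quadratic in \<open>key\<close>. There the quadratic equals
      \<open>t * sqnorm n w - t\<^sup>2\<close>, which is negative.\<close>
    define t where "t = - sqnorm n w / (d + 1)"
    have t: "t < 0" using p d by (simp add: t_def divide_neg_pos)
    have "t * (d + 1) = - sqnorm n w" using d by (simp add: t_def)
    then have "sqnorm n w = - (t * (d + 1))" by linarith
    then have "2 * t * sqnorm n w + t\<^sup>2 * d = t * sqnorm n w - t\<^sup>2"
      by (simp only:) (simp add: algebra_simps power2_eq_square)
    moreover have "t * sqnorm n w < 0" using t p by (rule mult_neg_pos)
    ultimately show False using key[of t] by (smt (verit) zero_le_power2)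
  qed
  then have "w i = 0" using coord_sq_le_sqnorm[OF i, of w] by simp
  then show ?thesis by (simp add: w_def g_def)
qed

text \<open>Pairing \<open>A u = k u\<close> with \<open>u\<close> exhibits \<open>k\<close> as a
  Rayleigh quotient, whose denominator is positive because \<open>u\<close> is nonzero.\<close>

lemma eigenvector_qform:
  assumes "A \<in> carrier_mat n n" "eigenvector A u k"
  shows "qform n A (vec_index u) = k * sqnorm n (vec_index u)" "sqnorm n (vec_index u) > 0"
proof -
  have u: "u \<in> carrier_vec n" "u \<noteq> 0\<^sub>v n" "A *\<^sub>v u = k \<cdot>\<^sub>v u"
    using assms by (auto simp: eigenvector_def)
  have row: "(\<Sum>j<n. A $$ (i, j) * vec_index u j) = k * vec_index u i" if "i < n" for i
  proof -
    have "vec_index (A *\<^sub>v u) i = k * vec_index u i"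
      using u that by simp
    then show ?thesis
      using u(1) assms(1) that by (simp add: scalar_prod_def atLeast0LessThan)
  qed
  have "qform n A (vec_index u) = (\<Sum>i<n. vec_index u i * (k * vec_index u i))"
    unfolding qform_eq_sum by (intro sum.cong) (auto simp: row)
  then show "qform n A (vec_index u) = k * sqnorm n (vec_index u)"
    by (simp add: sqnorm_def sum_distrib_left power2_eq_square algebra_simps)
  obtain i where "i < n" "vec_index u i \<noteq> 0"
    using u(1,2) by (metis carrier_vecD eq_vecI index_zero_vec)
  then show "sqnorm n (vec_index u) > 0"
    using coord_sq_le_sqnorm[of i n "vec_index u"]
    by (smt (verit) zero_less_power2)
qed

text \<open>The maximum of the form on the unit sphere is an eigenvalue by first variation, and no
  eigenvalue exceeds it, each being a Rayleigh quotient.\<close>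

lemma lambda1_rayleigh:
  assumes A: "A \<in> carrier_mat n n" and n: "n \<ge> 1"
    and sym: "\<And>i j. i < n \<Longrightarrow> j < n \<Longrightarrow> A $$ (i, j) = A $$ (j, i)"
  shows lambda1_upper: "qform n A x \<le> lambda1 A * sqnorm n x"
    and lambda1_attained: "\<exists>v. sqnorm n v = 1 \<and> qform n A v = lambda1 A"
proof -
  obtain v where v: "sqnorm n v = 1" "\<And>x. sqnorm n x = 1 \<Longrightarrow> qform n A x \<le> qform n A v"
    using qform_max_attained[OF n] by metis
  define l where "l = qform n A v"
  have bound: "qform n A x \<le> l * sqnorm n x" for x
    using v(2) by (intro qform_le_of_unit_bound) (simp add: l_def)
  have eig: "(\<Sum>j<n. A $$ (i, j) * v j) = l * v i" if "i < n" for i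
    by (rule qform_maximizer_eigen[OF sym bound _ that]) (simp_all add: l_def v(1))
  have "eigenvector A (Matrix.vec n v) l"
    unfolding eigenvector_def
  proof (intro conjI)
    show "Matrix.vec n v \<in> carrier_vec (dim_row A)" using A by simp
    show "Matrix.vec n v \<noteq> 0\<^sub>v (dim_row A)"
    proof
      assume "Matrix.vec n v = 0\<^sub>v (dim_row A)"
      then have "v i = 0" if "i < n" for i
        using A that by (metis carrier_matD(1) index_vec index_zero_vec(1))
      then show False using v(1) by (simp add: sqnorm_def)
    qed
    show "A *\<^sub>v Matrix.vec n v = l \<cdot>\<^sub>v Matrix.vec n v"
      using A eig by (intro eq_vecI) (auto simp: scalar_prod_def atLeast0LessThan)
  qed
  then have mem: "eigenvalue A l" by (auto simp: eigenvalue_def)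
  have le: "k \<le> l" if k: "eigenvalue A k" for k
  proof -
    obtain u where u: "eigenvector A u k" using k by (auto simp: eigenvalue_def)
    show ?thesis
      using bound[of "vec_index u"] eigenvector_qform[OF A u] by simp
  qed
  \<comment> \<open>\<open>Max\<close> is meaningful only on a finite set; the eigenvalues are the
    roots of a nonzero polynomial.\<close>
  have "char_poly A \<noteq> 0" using degree_monic_char_poly[OF A] by auto
  then have "finite {k. eigenvalue A k}"
    by (simp add: eigenvalue_root_char_poly[OF A] poly_roots_finite)
  then have "lambda1 A = l"
    unfolding lambda1_def using mem le by (intro Max_eqI) auto
  then show "qform n A x \<le> lambda1 A * sqnorm n x"
    and "\<exists>v. sqnorm n v = 1 \<and> qform n A v = lambda1 A"
    using bound v(1) l_def by auto
qed

section \<open>Sign and continuity of the largest eigenvalue\<close>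

text \<open>The form takes the value \<open>A $$ (0, 0)\<close> at the first unit vector. The sign
  serves both for test vectors of norm below 1 and for the square root in
  \<open>beta_star\<close>.\<close>

lemma lambda1_nonneg:
  assumes A: "A \<in> carrier_mat n n" and n: "n \<ge> 1"
    and sym: "\<And>i j. i < n \<Longrightarrow> j < n \<Longrightarrow> A $$ (i, j) = A $$ (j, i)"
    and nonneg: "A $$ (0, 0) \<ge> 0"
  shows "0 \<le> lambda1 A"
proof -
  let ?e = "\<lambda>i::nat. if i = 0 then 1 else 0 :: real"
  have "sqnorm n ?e = 1"
    using n by (simp add: sqnorm_def if_distrib[of "\<lambda>x. x\<^sup>2"] sum.delta cong: if_cong)
  moreover have "qform n A ?e = A $$ (0, 0)"
    using n by (simp add: qform_eq_sum if_distrib[of "(*) _"] mult_if_delta sum.delta cong: if_cong)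
  ultimately show ?thesis
    using lambda1_upper[OF A n sym, of ?e] nonneg by simp
qed

text \<open>A maximiser for \<open>A\<close> is a test vector for \<open>B\<close>, and coordinates
  of a unit vector have absolute value at most 1. Exchanging \<open>A\<close> and \<open>B\<close>
  yields the Lipschitz bound.\<close>

lemma lambda1_diff_le:
  assumes A: "A \<in> carrier_mat n n" and B: "B \<in> carrier_mat n n" and n: "n \<ge> 1"
    and symA: "\<And>i j. i < n \<Longrightarrow> j < n \<Longrightarrow> A $$ (i, j) = A $$ (j, i)"
    and symB: "\<And>i j. i < n \<Longrightarrow> j < n \<Longrightarrow> B $$ (i, j) = B $$ (j, i)"
  shows "lambda1 A - lambda1 B \<le> (\<Sum>i<n. \<Sum>j<n. \<bar>A $$ (i, j) - B $$ (i, j)\<bar>)"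
proof -
  obtain v where v: "sqnorm n v = 1" "qform n A v = lambda1 A"
    using lambda1_attained[OF A n symA] by blast
  have v1: "\<bar>v i\<bar> \<le> 1" if "i < n" for i
    using coord_sq_le_sqnorm[OF that, of v] v(1) by (simp add: abs_square_le_1)
  have "lambda1 A - lambda1 B \<le> qform n A v - qform n B v"
    using lambda1_upper[OF B n symB, of v] v by simp
  also have "\<dots> = (\<Sum>i<n. \<Sum>j<n. (A $$ (i, j) - B $$ (i, j)) * (v i * v j))"
    by (simp add: qform_def sum_subtractf algebra_simps)
  also have "\<dots> \<le> (\<Sum>i<n. \<Sum>j<n. \<bar>A $$ (i, j) - B $$ (i, j)\<bar>)"
  proof (intro sum_mono)
    fix i j assume "i \<in> {..<n}" "j \<in> {..<n}"
    then have "\<bar>v i * v j\<bar> \<le> 1"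
      using v1 by (simp add: abs_mult mult_le_one)
    then have "\<bar>(A $$ (i, j) - B $$ (i, j)) * (v i * v j)\<bar> \<le> \<bar>A $$ (i, j) - B $$ (i, j)\<bar>"
      by (simp add: abs_mult mult_left_le)
    then show "(A $$ (i, j) - B $$ (i, j)) * (v i * v j) \<le> \<bar>A $$ (i, j) - B $$ (i, j)\<bar>"
      by linarith
  qed
  finally show ?thesis .
qed

text \<open>\<open>lambda1_diff_le\<close>, used in both directions, bounds the error by a finite
  sum of terms tending to 0.\<close>

lemma tendsto_lambda1:
  assumes A: "\<And>N. A N \<in> carrier_mat n n" and B: "B \<in> carrier_mat n n" and n: "n \<ge> 1"
    and symA: "\<And>N i j. i < n \<Longrightarrow> j < n \<Longrightarrow> A N $$ (i, j) = A N $$ (j, i)"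
    and symB: "\<And>i j. i < n \<Longrightarrow> j < n \<Longrightarrow> B $$ (i, j) = B $$ (j, i)"
    and lim: "\<And>i j. i < n \<Longrightarrow> j < n \<Longrightarrow> ((\<lambda>N. A N $$ (i, j)) \<longlongrightarrow> B $$ (i, j)) F"
  shows "((\<lambda>N. lambda1 (A N)) \<longlongrightarrow> lambda1 B) F"
proof (rule LIM_zero_cancel, rule Lim_null_comparison)
  let ?d = "\<lambda>N. \<Sum>i<n. \<Sum>j<n. \<bar>A N $$ (i, j) - B $$ (i, j)\<bar>"
  have "norm (lambda1 (A N) - lambda1 B) \<le> ?d N" for N
    using lambda1_diff_le[OF A B n symA symB, of N] lambda1_diff_le[OF B A n symB symA, of N]
    by (simp add: abs_le_iff abs_minus_commute)
  then show "\<forall>\<^sub>F N in F. norm (lambda1 (A N) - lambda1 B) \<le> ?d N" by simp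
  show "(?d \<longlongrightarrow> 0) F"
    using lim by (intro tendsto_null_sum tendsto_rabs_zero LIM_zero) auto
qed

section \<open>Reduction to a matrix indexed by blocks\<close>

lemma weighted_mat_carrier:
  "\<Phi> \<in> carrier_mat n n \<Longrightarrow> weighted_mat n \<rho> \<Phi> \<in> carrier_mat n n"
  unfolding weighted_mat_def by (intro mult_carrier_mat[of _ n n]) simp_all

lemma weighted_mat_index:
  assumes "\<Phi> \<in> carrier_mat n n" "i < n" "j < n"
  shows "weighted_mat n \<rho> \<Phi> $$ (i, j) = sqrt (\<rho> i) * \<Phi> $$ (i, j) * sqrt (\<rho> j)"
  unfolding weighted_mat_def using assms
  by (simp add: mat_diag_mult_left[of _ n n] mat_diag_mult_right[of _ n n])

lemma qform_weighted_mat: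
  assumes "\<Phi> \<in> carrier_mat n n"
  shows "qform n (weighted_mat n \<rho> \<Phi>) z = qform n \<Phi> (\<lambda>a. sqrt (\<rho> a) * z a)"
  unfolding qform_def using assms
  by (intro sum.cong) (auto simp: weighted_mat_index algebra_simps)

lemma sum_by_blocks:
  fixes f :: "nat \<Rightarrow> real" and N n :: nat
  assumes "q \<in> {..<N} \<rightarrow> {..<n}"
  shows "(\<Sum>i<N. f i) = (\<Sum>a<n. \<Sum>i\<in>{i \<in> {..<N}. q i = a}. f i)"
  using sum.group[of "{..<N}" "{..<n}" q f] assms by (simp add: image_subset_iff Pi_iff)

text \<open>The entries are constant on each product of two blocks, so columns and then rows can be
  summed block by block.\<close>

lemma qform_block:
  assumes q: "q \<in> {..<N} \<rightarrow> {..<n}"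
    and A: "\<And>i j. i < N \<Longrightarrow> j < N \<Longrightarrow> A $$ (i, j) = \<Phi> $$ (q i, q j)"
  shows "qform N A x = qform n \<Phi> (\<lambda>a. \<Sum>i\<in>{i \<in> {..<N}. q i = a}. x i)"
proof -
  have "(\<Sum>j<N. A $$ (i, j) * x j)
      = (\<Sum>b<n. \<Phi> $$ (q i, b) * (\<Sum>j\<in>{j \<in> {..<N}. q j = b}. x j))" if "i < N" for i
    unfolding sum_by_blocks[OF q, of "\<lambda>j. A $$ (i, j) * x j"] sum_distrib_left
    using that by (intro sum.cong) (auto simp: A)
  then have "qform N A x
      = (\<Sum>i<N. x i * (\<Sum>b<n. \<Phi> $$ (q i, b) * (\<Sum>j\<in>{j \<in> {..<N}. q j = b}. x j)))"
    unfolding qform_eq_sum by (intro sum.cong) auto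
  also have "\<dots> = (\<Sum>a<n. (\<Sum>i\<in>{i \<in> {..<N}. q i = a}. x i)
      * (\<Sum>b<n. \<Phi> $$ (a, b) * (\<Sum>j\<in>{j \<in> {..<N}. q j = b}. x j)))"
    unfolding sum_by_blocks[OF q] sum_distrib_right
    by (intro sum.cong) auto
  finally show ?thesis by (simp add: qform_eq_sum)
qed

text \<open>Maximisers are transported both ways: block sums scaled by \<open>1 / sqrt (k a)\<close>
  lead from size \<open>N\<close> to size \<open>n\<close>, and block-constant vectors lead back.
  Neither map increases the norm, but Cauchy-Schwarz or empty blocks may lower it; since both values
  of \<open>lambda1\<close> are nonnegative, test vectors of norm at most 1 suffice.\<close>

lemma lambda1_block:
  assumes N: "N \<ge> 1" and n: "n \<ge> 1"
    and q: "q \<in> {..<N} \<rightarrow> {..<n}"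
    and A: "A \<in> carrier_mat N N" and \<Phi>: "\<Phi> \<in> carrier_mat n n"
    and blk: "\<And>i j. i < N \<Longrightarrow> j < N \<Longrightarrow> A $$ (i, j) = \<Phi> $$ (q i, q j)"
    and sym: "\<And>a b. a < n \<Longrightarrow> b < n \<Longrightarrow> \<Phi> $$ (a, b) = \<Phi> $$ (b, a)"
    and nonneg: "\<And>a. a < n \<Longrightarrow> 0 \<le> \<Phi> $$ (a, a)"
  defines "c \<equiv> \<lambda>a. real (card {i \<in> {..<N}. q i = a}) / real N"
  shows "lambda1 A / real N = lambda1 (weighted_mat n c \<Phi>)"
proof -
  let ?M = "weighted_mat n c \<Phi>"
  let ?B = "\<lambda>a. {i \<in> {..<N}. q i = a}"
  define k where "k = (\<lambda>a. real (card (?B a)))"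
  have k0: "k a \<ge> 0" for a by (simp add: k_def)
  have sqrt_c: "sqrt (c a) = sqrt (k a) / sqrt N" for a
    by (simp add: c_def k_def real_sqrt_divide)
  have symA: "A $$ (i, j) = A $$ (j, i)" if "i < N" "j < N" for i j
    using that q by (auto simp: blk Pi_iff intro: sym)
  have M: "?M \<in> carrier_mat n n" using \<Phi> by (rule weighted_mat_carrier)
  have symM: "?M $$ (i, j) = ?M $$ (j, i)" if "i < n" "j < n" for i j
    using that by (simp add: weighted_mat_index[OF \<Phi>] sym)
  have posA: "0 \<le> lambda1 A"
    using N q by (intro lambda1_nonneg[OF A N symA]) (auto simp: blk Pi_iff intro: nonneg)
  have posM: "0 \<le> lambda1 ?M"
    using n by (intro lambda1_nonneg[OF M n symM])
      (auto simp: weighted_mat_index[OF \<Phi>] c_def intro!: mult_nonneg_nonneg nonneg)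
  \<comment> \<open>The factor \<open>N\<close> enters the argument as \<open>sqrt N\<close> and
    turns the proportions \<open>c\<close> into the block sizes \<open>k\<close>.\<close>
  have qM: "real N * qform n ?M z = qform n \<Phi> (\<lambda>a. sqrt (k a) * z a)" for z
  proof -
    have "real N * qform n ?M z = (sqrt N)\<^sup>2 * qform n ?M z" by simp
    also have "\<dots> = qform n \<Phi> (\<lambda>a. sqrt N * (sqrt (c a) * z a))"
      by (simp only: qform_weighted_mat[OF \<Phi>] qform_scale)
    also have "\<dots> = qform n \<Phi> (\<lambda>a. sqrt (k a) * z a)"
      using N by (simp add: sqrt_c)
    finally show ?thesis .
  qed
  have empty: "k a = 0 \<Longrightarrow> ?B a = {}" for a
    by (simp add: k_def)
  have "lambda1 A \<le> real N * lambda1 ?M"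
  proof -
    obtain x where x: "sqnorm N x = 1" "qform N A x = lambda1 A"
      using lambda1_attained[OF A N symA] by blast
    define y where "y = (\<lambda>a. sum x (?B a))"
    \<comment> \<open>If block \<open>a\<close> is empty, then \<open>z a = y a / 0 = 0\<close> and \<open>y a = 0\<close>.\<close>
    define z where "z = (\<lambda>a. y a / sqrt (k a))"
    have y: "sqrt (k a) * z a = y a" for a
    proof (cases "k a = 0")
      case True
      then show ?thesis unfolding y_def empty[OF True] by simp
    next
      case False
      then show ?thesis by (simp add: z_def)
    qed
    have "(z a)\<^sup>2 \<le> (\<Sum>i\<in>?B a. (x i)\<^sup>2)" for a
    proof (cases "k a = 0")
      case True
      then show ?thesis by (simp add: z_def sum_nonneg)
    next
      case False
      \<comment> \<open>Cauchy-Schwarz against the constant 1 on the block, whose squared norm is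
        \<open>k a\<close>.\<close>
      have "(y a)\<^sup>2 \<le> k a * (\<Sum>i\<in>?B a. (x i)\<^sup>2)"
        using Cauchy_Schwarz_ineq_sum[of "\<lambda>_. 1" x "?B a"] by (simp add: y_def k_def)
      then show ?thesis using False k0[of a]
        by (simp add: z_def power_divide divide_simps mult.commute)
    qed
    then have "sqnorm n z \<le> sqnorm N x"
      unfolding sqnorm_def sum_by_blocks[OF q] by (intro sum_mono)
    then have z: "sqnorm n z \<le> 1" by (simp add: x(1))
    have "lambda1 A = qform n \<Phi> y"
      using qform_block[OF q blk, of x] x(2) by (simp add: y_def)
    also have "\<dots> = real N * qform n ?M z"
      by (simp add: qM y)
    also have "\<dots> \<le> real N * (lambda1 ?M * sqnorm n z)"
      by (intro mult_left_mono lambda1_upper[OF M n symM]) auto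
    also have "\<dots> \<le> real N * lambda1 ?M"
      using posM z by (intro mult_left_mono mult_left_le) auto
    finally show ?thesis .
  qed
  moreover have "real N * lambda1 ?M \<le> lambda1 A"
  proof -
    obtain z where z: "sqnorm n z = 1" "qform n ?M z = lambda1 ?M"
      using lambda1_attained[OF M n symM] by blast
    \<comment> \<open>Spreads \<open>z a\<close> evenly over block \<open>a\<close>: a nonempty
      block then has squared norm \<open>(z a)\<^sup>2\<close>, and its sum is the argument
      occurring in \<open>qM\<close>.\<close>
    define x where "x = (\<lambda>i. z (q i) / sqrt (k (q i)))"
    have sum_x: "sum x (?B a) = sqrt (k a) * z a" for a
    proof -
      have "sum x (?B a) = (\<Sum>i\<in>?B a. z a / sqrt (k a))"
        by (intro sum.cong) (auto simp: x_def)
      also have "\<dots> = k a * (z a / sqrt (k a))" by (simp add: k_def)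
      also have "\<dots> = sqrt (k a) * z a"
        using k0[of a] by (cases "k a = 0") (simp_all add: field_simps)
      finally show ?thesis .
    qed
    have "(\<Sum>i\<in>?B a. (x i)\<^sup>2) \<le> (z a)\<^sup>2" for a
    proof -
      have "(\<Sum>i\<in>?B a. (x i)\<^sup>2) = (\<Sum>i\<in>?B a. (z a)\<^sup>2 / k a)"
        using k0 by (intro sum.cong) (auto simp: x_def power_divide)
      also have "\<dots> = k a * ((z a)\<^sup>2 / k a)" by (simp add: k_def)
      \<comment> \<open>Equality holds unless the block is empty, where \<open>k a = 0\<close> makes
        the left side 0.\<close>
      also have "\<dots> \<le> (z a)\<^sup>2" by simp
      finally show ?thesis .
    qed
    then have "sqnorm N x \<le> sqnorm n z"
      unfolding sqnorm_def sum_by_blocks[OF q] by (intro sum_mono)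
    then have x: "sqnorm N x \<le> 1" by (simp add: z(1))
    have "real N * lambda1 ?M = qform N A x"
      using qform_block[OF q blk, of x, unfolded sum_x] qM[of z] z(2) by simp
    also have "\<dots> \<le> lambda1 A * sqnorm N x" by (rule lambda1_upper[OF A N symA])
    also have "\<dots> \<le> lambda1 A" using posA x by (intro mult_left_le)
    finally show ?thesis .
  qed
  ultimately show ?thesis using N by (simp add: field_simps)
qed

section \<open>Extended-real conventions and the limit\<close>

lemma recip_nonneg: "0 < x \<Longrightarrow> 0 \<le> recip x"
  by (cases x) (simp_all add: recip_def)

text \<open>For \<open>l = 0\<close> both sides are \<open>\<infinity>\<close>, which covers the
  case of a zero reciprocal matrix; for \<open>l > 0\<close> this is the real identity.\<close>

lemma ereal_sqrt_inverse:
  assumes "0 \<le> l"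
  shows "ereal_sqrt (1 / ereal l) = 1 / ereal (sqrt l)"
  using assms
  by (cases "l = 0") (auto simp: ereal_sqrt_def real_sqrt_divide ereal_divide one_ereal_def)

theorem proposition1p9:
  fixes \<Delta> :: "nat \<Rightarrow> ereal mat" and \<Delta>b :: "ereal mat" and n :: nat and \<rho> :: "nat \<Rightarrow> real"
  assumes "block_structured \<Delta> n \<Delta>b \<rho>"
  defines "X \<equiv> \<lambda>N. lambda1 (recip_mat (\<Delta> N)) / real N"
  shows "convergent X \<and>
         lim X = lambda1 (weighted_mat n \<rho> (recip_mat \<Delta>b)) \<and>
         beta_star n \<rho> \<Delta>b = 1 / ereal (sqrt (lim X))"
proof -
  let ?\<Phi> = "recip_mat \<Delta>b"
  let ?l = "lambda1 (weighted_mat n \<rho> ?\<Phi>)"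
  note bs = assms(1)[unfolded block_structured_def]
  have n: "n \<ge> 1" and \<rho>: "\<And>a. a < n \<Longrightarrow> 0 < \<rho> a"
    and vb: "variance_profile n \<Delta>b" and vN: "\<And>N. N \<ge> 1 \<Longrightarrow> variance_profile N (\<Delta> N)"
    using bs by simp_all
  obtain q where qblk: "\<forall>N\<ge>1. q N \<in> {..<N} \<rightarrow> {..<n} \<and>
      (\<forall>i<N. \<forall>j<N. \<Delta> N $$ (i, j) = \<Delta>b $$ (q N i, q N j))"
    and qlim: "\<forall>a<n. (\<lambda>N. real (card {i \<in> {..<N}. q N i = a}) / real N) \<longlonglongrightarrow> \<rho> a"
    using bs by (elim conjE exE) (rule that)
  have q: "q N \<in> {..<N} \<rightarrow> {..<n}" if "N \<ge> 1" for N
    using qblk that by blast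
  have blk: "\<Delta> N $$ (i, j) = \<Delta>b $$ (q N i, q N j)" if "N \<ge> 1" "i < N" "j < N" for N i j
    using qblk that by blast
  have lim: "(\<lambda>N. real (card {i \<in> {..<N}. q N i = a}) / real N) \<longlonglongrightarrow> \<rho> a" if "a < n" for a
    using qlim that by blast
  define c where "c = (\<lambda>N a. real (card {i \<in> {..<N}. q N i = a}) / real N)"
  have Db: "\<Delta>b \<in> carrier_mat n n" and \<Phi>: "?\<Phi> \<in> carrier_mat n n"
    using vb by (auto simp: variance_profile_def)
  have symD: "\<Delta>b $$ (i, j) = \<Delta>b $$ (j, i)" if "i < n" "j < n" for i j
    using vb that Db unfolding variance_profile_def by (metis carrier_matD index_transpose_mat(1))
  have sym: "?\<Phi> $$ (i, j) = ?\<Phi> $$ (j, i)" if "i < n" "j < n" for i j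
    using symD[OF that] that Db by simp
  have nonneg: "0 \<le> ?\<Phi> $$ (i, i)" if "i < n" for i
    using vb that Db by (auto simp: variance_profile_def intro: recip_nonneg)
  have symW: "weighted_mat n r ?\<Phi> $$ (i, j) = weighted_mat n r ?\<Phi> $$ (j, i)"
    if "i < n" "j < n" for r i j
    using that sym by (simp add: weighted_mat_index[OF \<Phi>] del: index_map_mat)
  \<comment> \<open>An exact identity for \<open>N \<ge> 1\<close>, so that only the weights
    \<open>c N\<close> still vary with \<open>N\<close>; the value at 0 is unconstrained.\<close>
  have "X N = lambda1 (weighted_mat n (c N) ?\<Phi>)" if "N \<ge> 1" for N
    unfolding X_def c_def
  proof (rule lambda1_block[OF that n q[OF that] _ \<Phi> _ sym nonneg])
    have DN: "\<Delta> N \<in> carrier_mat N N" using vN[OF that] by (simp add: variance_profile_def)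
    then show "recip_mat (\<Delta> N) \<in> carrier_mat N N" by simp
    fix i j assume ij: "i < N" "j < N"
    then show "recip_mat (\<Delta> N) $$ (i, j) = ?\<Phi> $$ (q N i, q N j)"
      using DN Db q[OF that] blk[OF that ij] by (simp add: Pi_iff)
  qed
  then have ev: "\<forall>\<^sub>F N in sequentially. lambda1 (weighted_mat n (c N) ?\<Phi>) = X N"
    by (auto simp: eventually_sequentially intro!: exI[of _ 1])
  \<comment> \<open>Each entry of the weighted matrix depends continuously on the weights, so
    \<open>c N\<close> tending to \<open>\<rho>\<close> gives entrywise convergence.\<close>
  have "(\<lambda>N. lambda1 (weighted_mat n (c N) ?\<Phi>)) \<longlonglongrightarrow> ?l"
  proof (rule tendsto_lambda1[OF weighted_mat_carrier[OF \<Phi>] weighted_mat_carrier[OF \<Phi>] n symW symW])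
    fix i j assume "i < n" "j < n"
    then show "(\<lambda>N. weighted_mat n (c N) ?\<Phi> $$ (i, j)) \<longlonglongrightarrow> weighted_mat n \<rho> ?\<Phi> $$ (i, j)"
      unfolding weighted_mat_index[OF \<Phi> \<open>i < n\<close> \<open>j < n\<close>] c_def
      by (intro tendsto_intros lim)
  qed
  then have X: "X \<longlonglongrightarrow> ?l" using ev by (rule Lim_transform_eventually)
  have "0 \<le> ?l"
  proof (rule lambda1_nonneg[OF weighted_mat_carrier[OF \<Phi>] n symW])
    show "0 \<le> weighted_mat n \<rho> ?\<Phi> $$ (0, 0)"
      using n nonneg[of 0] \<rho>[of 0]
      by (simp add: weighted_mat_index[OF \<Phi>] del: index_map_mat)
  qed
  then have "beta_star n \<rho> \<Delta>b = 1 / ereal (sqrt ?l)"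
    unfolding beta_star_def by (rule ereal_sqrt_inverse)
  with X limI[OF X] show ?thesis by (auto simp: convergent_def)
qed

end
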